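(* There exists a string family on which $\ell = \Omega(z_e\log n/\log\log n)$. That is, there is an infinite set $\mathcal{F}$ of strings such that $\ell(w)=\Omega\big(z_e(w)\log n/\log\log n\big)$ for $w\in\mathcal{F}$, where $n=|w|$.
   Context: A string family is an infinite set of finite strings of unbounded length; asymptotic notation on a family refers to strings $w$ of the family with $n=|w|\to\infty$ (with constants uniform over the family). $w[i:j]$ denotes the substring of $w$ from position $i$ to position $j$ (positions start at 1). L-systems: an L-system is a tuple $(\Sigma,\varphi,\tau,s,d,n)$, where $\Sigma$ is a finite alphabet, $\varphi:\Sigma^*\to\Sigma^*$ is a non-erasing monoid endomorphism (each rule $a\to\varphi(a)$, $a\in\Sigma$, has $|\varphi(a)|\ge 1$), $\tau:\Sigma^*\to\Sigma^*$ is a coding (a morphism with $|\tau(a)|=1$ for all $a\in\Sigma$), $s\in\Sigma^+$ is the axiom, and $d\ge 0$, $n\ge 1$ are integers. It generates the unique string $\tau(\varphi^d(s))[1:n]$ of length $n$. It is always assumed that $d=n^{O(1)}$ and $|\Sigma|=n^{O(1)}$ (each value fits in an $O(\log n)$-bit word). The size of the L-system is $\sum_{a\in\Sigma}|\varphi(a)|+|s|+|\Sigma|+2$. The measure $\ell(w)$ is the size of the smallest L-system generating $w$. LZ-End: the LZ-End parsing factorizes $w=w_1w_2\cdots w_k$ into non-empty phrases from left to right. Once $w_1,\dots,w_{i-1}$ have been produced, $w_i$ is the longest non-empty prefix of the remaining suffix of $w$ that has an occurrence inside $w_1\cdots w_{i-1}$ ending at the end of some previous phrase (i.e. it is a suffix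 of $w_1\cdots w_j$ for some $j<i$); if there is no such prefix, $w_i$ is the next single symbol. $z_e(w)$ is the number $k$ of phrases. *)

theory Defs
  imports Complex_Main "HOL-Library.Sublist" "HOL-Library.Landau_Symbols"
begin

section \<open>L-systems\<close>

text \<open>
  A monoid morphism on strings is given by its values on letters; only the values of
  \<open>rules\<close> and \<open>coding\<close> on \<open>alphabet\<close> matter.
\<close>

record 'a lsystem =
  alphabet :: "'a set"
  rules :: "'a \<Rightarrow> 'a list"
  coding :: "'a \<Rightarrow> 'a"
  axiom_str :: "'a list"
  depth :: nat
  out_len :: nat

definition morph :: "('a \<Rightarrow> 'b list) \<Rightarrow> 'a list \<Rightarrow> 'b list" where
  "morph f u = concat (map f u)"

definition iterated :: "'a lsystem \<Rightarrow> 'a list" where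
  "iterated L = (morph (rules L) ^^ depth L) (axiom_str L)"

definition wf_lsystem :: "'a lsystem \<Rightarrow> bool" where
  "wf_lsystem L \<longleftrightarrow>
     finite (alphabet L) \<and>
     (\<forall>a\<in>alphabet L. rules L a \<noteq> [] \<and> set (rules L a) \<subseteq> alphabet L) \<and>
     (\<forall>a\<in>alphabet L. coding L a \<in> alphabet L) \<and>
     axiom_str L \<noteq> [] \<and> set (axiom_str L) \<subseteq> alphabet L \<and>
     out_len L \<ge> 1"

text \<open>
  The generated string must have length exactly \<open>out_len L\<close>; the length condition is
  needed because \<^const>\<open>take\<close> silently truncates.
\<close>

definition generates :: "'a lsystem \<Rightarrow> 'a list \<Rightarrow> bool" where
  "generates L w \<longleftrightarrow>
     out_len L \<le> length (iterated L) \<and>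
     w = take (out_len L) (map (coding L) (iterated L))"

text \<open>
  The standing assumption that depth and alphabet size are \<open>n\<^sup>O\<^sup>(\<^sup>1\<^sup>)\<close>, with the
  exponent made explicit.
\<close>

definition poly_bounded :: "nat \<Rightarrow> 'a lsystem \<Rightarrow> bool" where
  "poly_bounded c L \<longleftrightarrow> depth L \<le> out_len L ^ c \<and> card (alphabet L) \<le> out_len L ^ c"

definition lsystem_size :: "'a lsystem \<Rightarrow> nat" where
  "lsystem_size L =
     (\<Sum>a\<in>alphabet L. length (rules L a)) + length (axiom_str L) + card (alphabet L) + 2"

text \<open>
  Letters are natural numbers, so an L-system may use any finite number of symbols
  that do not occur in \<open>w\<close>. For \<open>c \<ge> 1\<close> and \<open>w \<noteq> []\<close> the set below is nonempty,
  so the infimum is a minimum; otherwise it may be empty, and then \<open>Inf {} = 0\<close>.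
\<close>

definition ell :: "nat \<Rightarrow> nat list \<Rightarrow> nat" where
  "ell c w =
     Inf {lsystem_size L | L. wf_lsystem L \<and> poly_bounded c L \<and> generates L w}"


section \<open>LZ-End\<close>

text \<open>
  In the following, \<open>ps\<close> are the phrases produced so far and \<open>r\<close> is the rest of the string.
\<close>

definition ends_at_phrase :: "'a list list \<Rightarrow> 'a list \<Rightarrow> bool" where
  "ends_at_phrase ps u \<longleftrightarrow> (\<exists>j\<in>{1..length ps}. suffix u (concat (take j ps)))"

definition lz_end_len :: "'a list list \<Rightarrow> 'a list \<Rightarrow> nat" where
  "lz_end_len ps r =
     (let M = {m \<in> {1..length r}. ends_at_phrase ps (take m r)}
      in if M = {} then 1 else Max M)"

lemma lz_end_len_pos: "lz_end_len ps r \<ge> 1"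
proof -
  define M where "M = {m \<in> {1..length r}. ends_at_phrase ps (take m r)}"
  have "Max M \<in> M" if "M \<noteq> {}"
    using that by (intro Max_in) (auto simp: M_def)
  then show ?thesis
    unfolding lz_end_len_def M_def[symmetric] Let_def by (auto simp: M_def)
qed

function lz_end_from :: "'a list list \<Rightarrow> 'a list \<Rightarrow> 'a list list" where
  "lz_end_from ps r =
     (if r = [] then ps
      else lz_end_from (ps @ [take (lz_end_len ps r) r]) (drop (lz_end_len ps r) r))"
  by pat_completeness auto
termination
proof (relation "measure (\<lambda>(ps, r). length r)")
  fix ps :: "'a list list" and r :: "'a list"
  assume "r \<noteq> []"
  then show "((ps @ [take (lz_end_len ps r) r], drop (lz_end_len ps r) r), (ps, r))
      \<in> measure (\<lambda>(ps, r). length r)"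
    using lz_end_len_pos[of ps r] by (cases r) auto
qed simp

declare lz_end_from.simps [simp del]

definition lz_end :: "'a list \<Rightarrow> 'a list list" where
  "lz_end w = lz_end_from [] w"

definition z_e :: "'a list \<Rightarrow> nat" where
  "z_e w = length (lz_end w)"


section \<open>String families\<close>

definition string_family :: "'a list set \<Rightarrow> bool" where
  "string_family F \<longleftrightarrow> infinite F \<and> (\<forall>m. \<exists>w\<in>F. length w \<ge> m)"

text \<open>The filter of \<open>w \<in> F\<close> with \<open>length w\<close> tending to infinity.\<close>

definition along :: "'a list set \<Rightarrow> 'a list filter" where
  "along F = inf (filtercomap length at_top) (principal F)"

lemma eventually_along:
  "eventually P (along F) \<longleftrightarrow> (\<exists>N. \<forall>w\<in>F. length w \<ge> N \<longrightarrow> P w)"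
proof -
  have "(\<exists>Q. (\<exists>N. \<forall>n\<ge>N. Q n) \<and> (\<forall>w. Q (length w) \<longrightarrow> w \<in> F \<longrightarrow> P w)) \<longleftrightarrow>
        (\<exists>N. \<forall>w\<in>F. length w \<ge> N \<longrightarrow> P w)" (is "?L \<longleftrightarrow> ?R")
  proof
    assume ?R
    then obtain N where "\<forall>w\<in>F. length w \<ge> N \<longrightarrow> P w" ..
    then show ?L by (intro exI[of _ "\<lambda>n. n \<ge> N"]) auto
  qed blast
  then show ?thesis
    unfolding along_def eventually_inf_principal eventually_filtercomap eventually_at_top_linorder .
qed

end

theory Submission
  imports Defs
begin

text \<open>
  For \<open>k = 2\<^sup>j\<close> consider the words
  \<open>0\<^bsup>2^k\<^esup> 1 0\<^bsup>f\<^sub>1\<^esup> 2 0\<^bsup>f\<^sub>2\<^esup> \<dots> k 0\<^bsup>f\<^sub>k\<^esup>\<close> with \<open>1 \<le> f\<^sub>i \<le> 2\<^sup>k\<close>. LZ-End parses the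
  initial run by doubling into \<open>k + 1\<close> phrases; afterwards each separator is new, and each run is
  one phrase, because it is a suffix of the initial run. So there are only \<open>3k + 1\<close> phrases. But there
  are \<open>2\<^bsup>k^2\<^esup>\<close> such words, whereas L-systems of size below \<open>q\<close> and depth below \<open>2\<^bsup>k^2/4\<^esup>\<close> generate
  only \<open>2\<^bsup>O(q log k) + k^2/4 + O(k)\<^esup>\<close> of them. Hence for \<open>q\<close> of order \<open>k\<^sup>2 / log k\<close> some word has
  no such L-system. Since the length is \<open>2\<^bsup>O(k)\<^esup>\<close>, the depth bound eventually exceeds \<open>n\<^sup>c\<close> for
  every \<open>c\<close>, so a single family works for all \<open>c\<close>.
\<close>

section \<open>Parsing the words\<close>

lemma ends_at_phrase_length:
  "ends_at_phrase ps u \<Longrightarrow> length u \<le> length (concat ps)"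
proof -
  assume "ends_at_phrase ps u"
  then obtain j where "suffix u (concat (take j ps))"
    by (auto simp: ends_at_phrase_def)
  then have "length u \<le> length (concat (take j ps))"
    by (rule suffix_length_le)
  also have "\<dots> \<le> length (concat (take j ps) @ concat (drop j ps))" by simp
  also have "concat (take j ps) @ concat (drop j ps) = concat ps"
    by (metis append_take_drop_id concat_append)
  finally show ?thesis .
qed

lemma ends_at_phrase_set:
  "ends_at_phrase ps u \<Longrightarrow> set u \<subseteq> set (concat ps)"
proof -
  assume "ends_at_phrase ps u"
  then obtain j where "suffix u (concat (take j ps))"
    by (auto simp: ends_at_phrase_def)
  then have "set u \<subseteq> set (concat (take j ps))"
    by (rule set_mono_suffix)
  also have "\<dots> \<subseteq> set (concat ps)"
    using set_take_subset[of j ps] by auto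
  finally show ?thesis .
qed

lemma ends_at_phrase_append:
  "ends_at_phrase ps u \<Longrightarrow> ends_at_phrase (ps @ qs) u"
  unfolding ends_at_phrase_def by (force intro: bexI)

lemma ends_at_phrase_suffix:
  "ends_at_phrase ps u \<Longrightarrow> suffix v u \<Longrightarrow> ends_at_phrase ps v"
  unfolding ends_at_phrase_def using suffix_order.trans by blast

lemma ends_at_phrase_concat:
  "ps \<noteq> [] \<Longrightarrow> ends_at_phrase ps (concat ps)"
  unfolding ends_at_phrase_def
  by (intro bexI[of _ "length ps"]) (auto simp: Suc_le_eq)

text \<open>The length of \<open>u\<close> is a candidate and \<open>max\<close> excludes every
  larger one, so the greedy choice is exactly \<open>u\<close>.\<close>

lemma lz_end_from_copy:
  assumes "u \<noteq> []" "ends_at_phrase ps u"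
    and max: "\<And>m. length u < m \<Longrightarrow> m \<le> length (u @ v) \<Longrightarrow> \<not> ends_at_phrase ps (take m (u @ v))"
  shows "lz_end_from ps (u @ v) = lz_end_from (ps @ [u]) v"
proof -
  let ?M = "{m \<in> {1..length (u @ v)}. ends_at_phrase ps (take m (u @ v))}"
  have in_M: "length u \<in> ?M"
    using assms(1,2) by (auto simp: Suc_le_eq)
  have "Max ?M = length u"
  proof (rule Max_eqI)
    show "finite ?M" by (rule finite_subset[of _ "{1..length (u @ v)}"]) auto
    show "m \<le> length u" if "m \<in> ?M" for m
      using that max[of m] by (cases "length u < m") auto
  qed (rule in_M)
  then have "lz_end_len ps (u @ v) = length u"
    unfolding lz_end_len_def Let_def using in_M by (metis empty_iff)
  then show ?thesis
    using assms(1) by (subst lz_end_from.simps) simp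
qed

text \<open>Every non-empty prefix contains the unseen letter \<open>x\<close>, so there is no
  candidate and the default phrase length 1 applies.\<close>

lemma lz_end_from_new:
  assumes "x \<notin> set (concat ps)"
  shows "lz_end_from ps (x # v) = lz_end_from (ps @ [[x]]) v"
proof -
  have "\<not> ends_at_phrase ps (take m (x # v))" if "m \<ge> 1" for m
    using that assms ends_at_phrase_set[of ps "take m (x # v)"] by (cases m) auto
  then have "lz_end_len ps (x # v) = 1"
    unfolding lz_end_len_def Let_def by auto
  then show ?thesis
    by (subst lz_end_from.simps) simp
qed

text \<open>The separators increase, so when the starting index is positive each one is a letter not
  seen before in the word.\<close>

fun blocks :: "nat \<Rightarrow> nat list \<Rightarrow> nat list" where
  "blocks i [] = []"
| "blocks i (x # xs) = i # replicate x 0 @ blocks (Suc i) xs"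

definition runs_word :: "nat \<Rightarrow> nat list \<Rightarrow> nat list" where
  "runs_word k fs = replicate (2 ^ k) 0 @ blocks 1 fs"

text \<open>The whole parsed text ends at the last phrase, so it can be copied, and no source is
  longer than the parsed text. Hence each phrase doubles the run. The general start \<open>i\<close>
  serves the induction on \<open>d\<close>.\<close>

lemma lz_end_from_doubling:
  assumes "length ps = Suc i" "concat ps = replicate (2 ^ i) a"
  shows "\<exists>qs. length qs = Suc (i + d) \<and> concat qs = replicate (2 ^ (i + d)) a \<and>
    lz_end_from ps (replicate (2 ^ (i + d) - 2 ^ i) a @ v) = lz_end_from qs v"
  using assms
proof (induction d arbitrary: i ps)
  case 0
  then show ?case by auto
next
  case (Suc d)
  let ?u = "replicate (2 ^ i) a"
  let ?rest = "replicate (2 ^ (Suc i + d) - 2 ^ Suc i) a @ v"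
  have "ends_at_phrase ps ?u"
    using ends_at_phrase_concat[of ps] Suc.prems by (cases ps) auto
  moreover have "\<not> ends_at_phrase ps (take m (?u @ ?rest))"
    if "length ?u < m" "m \<le> length (?u @ ?rest)" for m
  proof
    assume "ends_at_phrase ps (take m (?u @ ?rest))"
    then have "length (take m (?u @ ?rest)) \<le> length ?u"
      using ends_at_phrase_length Suc.prems(2) by metis
    with that show False by (simp only: length_take min_def split: if_splits)
  qed
  ultimately have step: "lz_end_from ps (?u @ ?rest) = lz_end_from (ps @ [?u]) ?rest"
    by (intro lz_end_from_copy) auto
  have "concat (ps @ [?u]) = replicate (2 ^ Suc i) a"
    using Suc.prems(2) by (simp add: replicate_add[symmetric] mult_2)
  with Suc.IH[of "ps @ [?u]" "Suc i"] Suc.prems(1)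
  obtain qs where qs: "length qs = Suc (Suc i + d)" "concat qs = replicate (2 ^ (Suc i + d)) a"
    "lz_end_from (ps @ [?u]) ?rest = lz_end_from qs v"
    by auto
  have "2 ^ Suc i \<le> (2::nat) ^ (Suc i + d)"
    by (intro power_increasing) auto
  then have "2 ^ i + (2 ^ (Suc i + d) - 2 ^ Suc i) = 2 ^ (i + Suc d) - (2::nat) ^ i"
    by simp
  then have "replicate (2 ^ (i + Suc d) - 2 ^ i) a @ v = ?u @ ?rest"
    by (simp only: append_assoc[symmetric] replicate_add[symmetric])
  with step qs show ?case
    by (intro exI[of _ qs]) simp
qed

text \<open>Each entry costs two phrases: a fresh separator, then a run that is a suffix of the
  \<open>n\<close> zeros already available. A longer phrase would contain the next separator, which
  has not occurred yet.\<close>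

lemma lz_end_from_blocks:
  assumes "\<forall>x\<in>set (concat ps). x < i" "i \<ge> 1" "ends_at_phrase ps (replicate n 0)"
    "\<forall>f\<in>set fs. 1 \<le> f \<and> f \<le> n"
  shows "length (lz_end_from ps (blocks i fs)) = length ps + 2 * length fs"
  using assms
proof (induction fs arbitrary: i ps)
  case Nil
  then show ?case by (simp add: lz_end_from.simps)
next
  case (Cons f fs)
  let ?ps = "ps @ [[i]]" and ?u = "replicate f (0::nat)" and ?v = "blocks (Suc i) fs"
  have new: "lz_end_from ps (blocks i (f # fs)) = lz_end_from ?ps (?u @ ?v)"
    using Cons.prems(1) by (simp, intro lz_end_from_new) auto
  have "suffix ?u (replicate n 0)"
    using Cons.prems(4) by (intro suffixI[of _ "replicate (n - f) 0"]) (simp add: replicate_add[symmetric])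
  then have u: "ends_at_phrase ?ps ?u"
    using Cons.prems(3) ends_at_phrase_append ends_at_phrase_suffix by blast
  have "\<not> ends_at_phrase ?ps (take m (?u @ ?v))"
    if m: "length ?u < m" "m \<le> length (?u @ ?v)" for m
  proof (cases fs)
    case (Cons g gs)
    then have "Suc i \<in> set (take m (?u @ ?v))"
      using m by (auto simp: take_Cons' )
    moreover have "Suc i \<notin> set (concat ?ps)"
      using Cons.prems(1) by fastforce
    ultimately show ?thesis
      using ends_at_phrase_set by blast
  qed (use m in auto)
  then have "lz_end_from ?ps (?u @ ?v) = lz_end_from (?ps @ [?u]) ?v"
    using u Cons.prems(4) by (intro lz_end_from_copy) auto
  moreover have "length (lz_end_from (?ps @ [?u]) ?v) = length (?ps @ [?u]) + 2 * length fs"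
    using Cons.prems by (intro Cons.IH ends_at_phrase_append) (auto simp: less_Suc_eq)
  ultimately show ?case
    using new by simp
qed

lemma z_e_runs_word:
  assumes "\<forall>f\<in>set fs. 1 \<le> f \<and> f \<le> 2 ^ k"
  shows "z_e (runs_word k fs) = k + 1 + 2 * length fs"
proof -
  obtain qs where qs: "length qs = Suc k" "concat qs = replicate (2 ^ k) (0::nat)"
    "lz_end_from [[0]] (replicate (2 ^ k - 1) 0 @ blocks 1 fs) = lz_end_from qs (blocks 1 fs)"
    using lz_end_from_doubling[of "[[0]]" 0 "0::nat" k "blocks 1 fs"] by auto
  \<comment> \<open>The first zero is a phrase of its own; \<open>k\<close> doublings then produce
    the remaining \<open>2 ^ k - 1\<close> zeros.\<close>
  have "runs_word k fs = 0 # replicate (2 ^ k - 1) 0 @ blocks 1 fs"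
    unfolding runs_word_def by (simp flip: replicate_Suc append_Cons)
  then have "lz_end (runs_word k fs) = lz_end_from qs (blocks 1 fs)"
    unfolding lz_end_def using lz_end_from_new[of "0::nat" "[]"] qs(3) by simp
  moreover have "qs \<noteq> []"
    using qs(1) by auto
  then have "ends_at_phrase qs (replicate (2 ^ k) 0)"
    using ends_at_phrase_concat qs(2) by metis
  then have "length (lz_end_from qs (blocks 1 fs)) = length qs + 2 * length fs"
    using assms qs(2) by (intro lz_end_from_blocks) auto
  ultimately show ?thesis
    unfolding z_e_def using qs(1) by simp
qed

section \<open>Length, letters and injectivity of the words\<close>

lemma length_blocks: "length (blocks i fs) = length fs + sum_list fs"
  by (induction i fs rule: blocks.induct) auto

lemma set_blocks: "set (blocks i fs) \<subseteq> {..<i + length fs} \<union> {0}"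
  by (induction i fs rule: blocks.induct) auto

lemma blocks_inj:
  assumes "blocks (Suc i) fs = blocks (Suc i) gs"
  shows "fs = gs"
  using assms
proof (induction fs arbitrary: i gs)
  case Nil
  then show ?case by (cases gs) auto
next
  case (Cons f fs)
  then obtain g gs' where gs: "gs = g # gs'" by (cases gs) auto
  \<comment> \<open>The run is followed by a nonzero separator or by the end of the word, so its
    length can be read off.\<close>
  have run: "takeWhile ((=) 0) (replicate x 0 @ blocks (Suc (Suc i)) xs) = replicate x 0" for x xs
    by (subst takeWhile_append2) (auto, cases xs, auto)
  have "replicate f 0 @ blocks (Suc (Suc i)) fs = replicate g 0 @ blocks (Suc (Suc i)) gs'"
    using Cons.prems gs by simp
  moreover from this have "f = g"
    using run by (metis length_replicate)
  ultimately show ?case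
    using Cons.IH[of "Suc i" gs'] gs by simp
qed

lemma length_runs_word_le:
  assumes "length fs = k" "\<forall>f\<in>set fs. f \<le> 2 ^ k"
  shows "length (runs_word k fs) < 2 ^ (2 * k + 1)"
proof -
  have "k + 1 \<le> 2 ^ k"
    using less_exp[of k] by (simp only: Suc_eq_plus1[symmetric] Suc_le_eq)
  have "sum_list fs \<le> k * 2 ^ k"
    using sum_list_mono[of fs id "\<lambda>_. 2 ^ k"] assms by (simp add: sum_list_triv)
  then have "length (runs_word k fs) \<le> 2 ^ k + k + k * 2 ^ k"
    using assms(1) by (simp add: runs_word_def length_blocks)
  also have "\<dots> < (k + 1) * (2 ^ k + 1)"
    by simp
  also have "\<dots> \<le> 2 ^ k * (2 * 2 ^ k)"
    using \<open>k + 1 \<le> 2 ^ k\<close> by (intro mult_mono) auto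
  also have "\<dots> = 2 ^ (2 * k + 1)"
    by (simp add: power_add power_mult power2_eq_square mult_2 algebra_simps)
  finally show ?thesis .
qed

section \<open>Counting L-systems\<close>

lemma morph_Nil [simp]: "morph f [] = []"
  and morph_Cons [simp]: "morph f (x # xs) = f x @ morph f xs"
  by (simp_all add: morph_def)

lemma set_morph: "set (morph f u) = (\<Union>x\<in>set u. set (f x))"
  by (induction u) auto

lemma morph_rename:
  assumes "\<And>a. a \<in> set u \<Longrightarrow> g (h a) = map h (f a)"
  shows "morph g (map h u) = map h (morph f u)"
  using assms by (induction u) auto

text \<open>The renaming law is known only on \<open>A\<close>, so the induction also has to carry
  along that the iterates stay over \<open>A\<close>.\<close>

lemma funpow_morph_rename:
  assumes "\<And>a. a \<in> A \<Longrightarrow> g (h a) = map h (f a)" "\<And>a. a \<in> A \<Longrightarrow> set (f a) \<subseteq> A" "set u \<subseteq> A"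
  shows "(morph g ^^ d) (map h u) = map h ((morph f ^^ d) u) \<and> set ((morph f ^^ d) u) \<subseteq> A"
proof (induction d)
  case 0
  then show ?case using assms(3) by simp
next
  case (Suc d)
  then have sub: "set ((morph f ^^ d) u) \<subseteq> A"
    and eq: "(morph g ^^ d) (map h u) = map h ((morph f ^^ d) u)" by auto
  have "set (morph f ((morph f ^^ d) u)) \<subseteq> A"
    using sub assms(2) by (fastforce simp: set_morph)
  then show ?case
    using morph_rename[of "(morph f ^^ d) u" g h f] assms(1) sub eq by auto
qed

text \<open>Storing all right-hand sides as two flat lists lets the encoding be counted by plain
  lists of bounded length.\<close>

fun unconcat :: "nat list \<Rightarrow> 'a list \<Rightarrow> 'a list list" where
  "unconcat [] xs = []"
| "unconcat (n # ns) xs = take n xs # unconcat ns (drop n xs)"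

lemma unconcat_concat: "unconcat (map length xss) (concat xss) = xss"
  by (induction xss) auto

text \<open>
  An L-system over the letters \<open>0, 1, \<dots>\<close> is encoded by the lengths of its right-hand sides, their
  concatenation, its coding, axiom, depth and output length.
\<close>

definition decode ::
  "nat list \<times> nat list \<times> nat list \<times> nat list \<times> nat \<times> nat \<Rightarrow> nat list" where
  "decode = (\<lambda>(ns, xs, cs, s, d, n).
     take n (map ((!) cs) ((morph ((!) (unconcat ns xs)) ^^ d) s)))"

section \<open>Number of short lists and of generated words\<close>

lemma sum_power_less: "(\<Sum>i<q. B ^ i) < B ^ q" if "B \<ge> 2" for B q :: nat
proof (induction q)
  case (Suc q)
  then have "(\<Sum>i<Suc q. B ^ i) < 2 * B ^ q" by simp
  also have "\<dots> \<le> B ^ Suc q" using that by simp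
  finally show ?case .
qed simp

lemma card_short_lists:
  fixes B q :: nat
  assumes "B \<ge> 2"
  shows "finite {xs. set xs \<subseteq> {..<B} \<and> length xs < q}"
    and "card {xs. set xs \<subseteq> {..<B} \<and> length xs < q} \<le> B ^ q"
proof -
  have "finite {xs. set xs \<subseteq> {..<B} \<and> length xs < q} \<and>
    card {xs. set xs \<subseteq> {..<B} \<and> length xs < q} = (\<Sum>i<q. B ^ i)"
  proof (cases q)
    case (Suc p)
    then show ?thesis
      using finite_lists_length_le[of "{..<B}" p] card_lists_length_le[of "{..<B}" p]
      by (simp add: less_Suc_eq_le lessThan_Suc_atMost)
  qed simp
  then show "finite {xs. set xs \<subseteq> {..<B} \<and> length xs < q}"
    and "card {xs. set xs \<subseteq> {..<B} \<and> length xs < q} \<le> B ^ q"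
    using sum_power_less[OF assms, of q] by auto
qed

text \<open>A bijection of the alphabet onto an initial segment of the naturals turns rules and
  axiom into numbers below \<open>B\<close>, since the alphabet has fewer than \<open>q\<close>
  letters. The values of the coding are not renamed, because they must spell
  \<open>w\<close>.\<close>

lemma decode_complete:
  assumes wf: "wf_lsystem L" and size: "lsystem_size L < q" and "q \<le> B"
    and gen: "generates L w" and w: "set w \<subseteq> {..<B}"
  shows "\<exists>ns xs cs s. (\<forall>l\<in>{ns, xs, cs, s}. set l \<subseteq> {..<B} \<and> length l < q) \<and>
    w = decode (ns, xs, cs, s, depth L, length w)"
proof -
  define \<sigma> where "\<sigma> = card (alphabet L)"
  obtain h where h: "bij_betw h (alphabet L) {0..<\<sigma>}"
    using ex_bij_betw_finite_nat[of "alphabet L"] wf unfolding wf_lsystem_def \<sigma>_def by auto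
  define g where "g = inv_into (alphabet L) h"
  have g: "bij_betw g {0..<\<sigma>} (alphabet L)"
    unfolding g_def using h by (rule bij_betw_inv_into)
  have h_less: "h a < \<sigma>" and g_h: "g (h a) = a" if "a \<in> alphabet L" for a
    using that h by (auto simp: g_def bij_betw_def)
  \<comment> \<open>The coding may leave \<open>{..<B}\<close> on letters that are only used beyond the prefix \<open>w\<close>.\<close>
  define c where "c a = (if coding L a < B then coding L a else 0)" for a
  define rs where "rs = map (\<lambda>i. map h (rules L (g i))) [0..<\<sigma>]"
  define cs where "cs = map (\<lambda>i. c (g i)) [0..<\<sigma>]"
  define s where "s = map h (axiom_str L)"
  have closed: "set (rules L a) \<subseteq> alphabet L" if "a \<in> alphabet L" for a
    using wf that by (auto simp: wf_lsystem_def)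
  have ax: "set (axiom_str L) \<subseteq> alphabet L"
    using wf by (auto simp: wf_lsystem_def)
  have "length (concat rs) = (\<Sum>i = 0..<\<sigma>. length (rules L (g i)))"
    by (simp add: rs_def length_concat o_def sum_list_distinct_conv_sum_set)
  also have "\<dots> = (\<Sum>a\<in>alphabet L. length (rules L a))"
    using g by (rule sum.reindex_bij_betw)
  finally have total: "length (concat rs) + length s + \<sigma> + 2 < q"
    using size by (simp add: lsystem_size_def s_def \<sigma>_def)
  have g_in: "g i \<in> alphabet L" if "i < \<sigma>" for i
    using that g by (auto simp: bij_betw_def)
  have "length r < B" if "r \<in> set rs" for r
  proof -
    have "length r \<le> length (concat rs)"
      using that by (simp add: length_concat member_le_sum_list)
    then show ?thesis using total \<open>q \<le> B\<close> by simp
  qed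
  then have ns_ok: "set (map length rs) \<subseteq> {..<B}" by auto
  have h_ok: "h ` X \<subseteq> {..<B}" if "X \<subseteq> alphabet L" for X
    using h_less that total \<open>q \<le> B\<close> by fastforce
  have s_ok: "set s \<subseteq> {..<B}"
    using h_ok[OF ax] by (simp add: s_def)
  have "set r \<subseteq> {..<B}" if "r \<in> set rs" for r
    using that h_ok closed g_in unfolding rs_def by (metis (no_types, lifting) atLeastLessThan_iff
      imageE set_map set_upt)
  then have xs_ok: "set (concat rs) \<subseteq> {..<B}" by auto
  have "0 < B" using total \<open>q \<le> B\<close> by simp
  then have cs_ok: "set cs \<subseteq> {..<B}"
    by (auto simp: cs_def c_def)
  have iter: "(morph ((!) rs) ^^ depth L) s = map h (iterated L)"
    and iter_sub: "set (iterated L) \<subseteq> alphabet L"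
    using funpow_morph_rename[of "alphabet L" "(!) rs" h "rules L" "axiom_str L" "depth L"]
      closed ax h_less g_h by (auto simp: iterated_def s_def rs_def)
  have len: "length w = out_len L" and w_eq: "w = take (out_len L) (map (coding L) (iterated L))"
    using gen by (auto simp: generates_def)
  have "map ((!) cs) (map h (iterated L)) = map c (iterated L)"
    using iter_sub h_less g_h by (auto simp: cs_def)
  then have "decode (map length rs, concat rs, cs, s, depth L, length w) =
      take (out_len L) (map c (iterated L))"
    unfolding decode_def by (simp add: unconcat_concat iter len del: map_map)
  also have "\<dots> = map (\<lambda>x. if x < B then x else 0) w"
    by (subst w_eq) (simp add: take_map c_def)
  also have "\<dots> = w"
    using w by (intro map_idI) auto
  finally show ?thesis
    using ns_ok xs_ok cs_ok s_ok total
    by (intro exI[of _ "map length rs"] exI[of _ "concat rs"] exI[of _ cs] exI[of _ s])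
       (auto simp: rs_def cs_def)
qed

text \<open>Every word of \<open>W\<close> is decoded from four lists with at most
  \<open>B ^ q\<close> choices each, a depth below \<open>D\<close> and a length below
  \<open>N\<close>.\<close>

lemma card_generated_le:
  fixes B q D N :: nat
  assumes "B \<ge> 2" "q \<le> B"
    and W: "\<And>w. w \<in> W \<Longrightarrow> set w \<subseteq> {..<B} \<and> length w < N \<and>
      (\<exists>L. wf_lsystem L \<and> lsystem_size L < q \<and> depth L < D \<and> generates L w)"
  shows "card W \<le> B ^ (4 * q) * D * N"
proof -
  define S where "S = {xs. set xs \<subseteq> {..<B} \<and> length xs < q}"
  let ?T = "S \<times> S \<times> S \<times> S \<times> {..<D} \<times> {..<N}"
  have S: "finite S" "card S \<le> B ^ q"
    unfolding S_def using card_short_lists[OF assms(1)] by auto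
  have "W \<subseteq> decode ` ?T"
  proof
    fix w assume "w \<in> W"
    with W obtain L where L: "set w \<subseteq> {..<B}" "length w < N" "wf_lsystem L"
      "lsystem_size L < q" "depth L < D" "generates L w" by blast
    then obtain ns xs cs s where
      "\<forall>l\<in>{ns, xs, cs, s}. set l \<subseteq> {..<B} \<and> length l < q"
      "w = decode (ns, xs, cs, s, depth L, length w)"
      using decode_complete[OF _ _ assms(2)] by metis
    with L show "w \<in> decode ` ?T"
      by (intro image_eqI[of _ _ "(ns, xs, cs, s, depth L, length w)"]) (auto simp: S_def)
  qed
  then have "card W \<le> card ?T"
    using S(1) by (intro surj_card_le) auto
  also have "\<dots> = card S ^ 4 * D * N"
    by (simp add: card_cartesian_product power4_eq_xxxx)
  also have "\<dots> \<le> (B ^ q) ^ 4 * D * N"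
    using S(2) by (intro mult_right_mono power_mono) auto
  finally show ?thesis by (simp add: power_mult mult.commute)
qed

section \<open>The family\<close>

definition admissible :: "nat \<Rightarrow> nat list set" where
  "admissible k = {fs. set fs \<subseteq> {1..2 ^ k} \<and> length fs = k}"

text \<open>With \<open>k = 2 ^ j\<close> this is about k^2 / (8 (2 log k + 1)). It makes the four
  lists of the encoding, over an alphabet of size \<open>2 ^ (2 * j + 1)\<close>, contribute a
  factor of at most 2^(k^2/2).\<close>

definition size_bound :: "nat \<Rightarrow> nat" where
  "size_bound j = 4 ^ j div (8 * (2 * j + 1))"

lemma size_bound_le: "8 * (2 * j + 1) * size_bound j \<le> 4 ^ j"
  unfolding size_bound_def by (rule times_div_less_eq_dividend)

lemma four_power: "(4::nat) ^ j = 2 ^ (2 * j)"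
  by (simp add: power_mult)

text \<open>If every word were easy, comparing exponents would give k^2 \<le> k^2/2 + k^2/4 + 2k +
  1, which fails for k \<ge> 16. At k = 8 it still holds, hence \<open>j \<ge> 4\<close>.\<close>

lemma exists_hard_word:
  assumes "j \<ge> 4"
  shows "\<exists>fs\<in>admissible (2 ^ j). \<forall>L. wf_lsystem L \<longrightarrow> depth L < 2 ^ 4 ^ (j - 1) \<longrightarrow>
    generates L (runs_word (2 ^ j) fs) \<longrightarrow> size_bound j \<le> lsystem_size L"
proof (rule ccontr)
  assume easy: "\<not> ?thesis"
  define k :: nat where "k = 2 ^ j"
  \<comment> \<open>This exceeds every letter \<open>0, ..., k\<close> and also the size bound,
    while \<open>log 2 B\<close> is still linear in \<open>j\<close>.\<close>
  define B :: nat where "B = 2 ^ (2 * j + 1)"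
  let ?W = "runs_word k ` admissible k"
  have "k < B"
    unfolding k_def B_def by (intro power_strict_increasing) auto
  have "size_bound j \<le> 4 ^ j"
    by (simp add: size_bound_def)
  then have "size_bound j \<le> B"
    by (simp add: B_def four_power)
  have "card ?W \<le> B ^ (4 * size_bound j) * 2 ^ 4 ^ (j - 1) * 2 ^ (2 * k + 1)"
  proof (rule card_generated_le)
    show "2 \<le> B" by (simp add: B_def)
    show "size_bound j \<le> B" by fact
    fix w assume "w \<in> ?W"
    then obtain fs where fs: "fs \<in> admissible k" and w: "w = runs_word k fs" by auto
    have "set w \<subseteq> {..<B}"
      using set_blocks[of 1 fs] \<open>k < B\<close> fs by (fastforce simp: w runs_word_def admissible_def)
    moreover have "length w < 2 ^ (2 * k + 1)"
      unfolding w using fs by (intro length_runs_word_le) (auto simp: admissible_def)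
    moreover have "\<exists>L. wf_lsystem L \<and> lsystem_size L < size_bound j \<and>
        depth L < 2 ^ 4 ^ (j - 1) \<and> generates L w"
      using easy fs unfolding w k_def by (meson not_le)
    ultimately show "set w \<subseteq> {..<B} \<and> length w < 2 ^ (2 * k + 1) \<and>
      (\<exists>L. wf_lsystem L \<and> lsystem_size L < size_bound j \<and>
        depth L < 2 ^ 4 ^ (j - 1) \<and> generates L w)" by blast
  qed
  moreover have "card ?W = 2 ^ (4 ^ j)"
  proof -
    have "inj_on (runs_word k) (admissible k)"
      by (rule inj_onI) (auto simp: runs_word_def dest: blocks_inj[of 0, simplified])
    then have "card ?W = card (admissible k)" by (rule card_image)
    also have "\<dots> = (2 ^ k) ^ k"
      unfolding admissible_def by (simp add: card_lists_length_eq)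
    also have "\<dots> = 2 ^ (4 ^ j)"
      by (simp add: k_def four_power flip: power_mult power_add mult_2)
    finally show ?thesis .
  qed
  ultimately have "(2::nat) ^ 4 ^ j \<le>
      2 ^ ((2 * j + 1) * (4 * size_bound j) + 4 ^ (j - 1) + (2 * k + 1))"
    by (simp only: B_def power_mult power_add)
  then have exps: "4 ^ j \<le> (2 * j + 1) * (4 * size_bound j) + 4 ^ (j - 1) + (2 * k + 1)"
    by (rule power_le_imp_le_exp[rotated]) simp
  \<comment> \<open>With x = 2^i the remaining inequality reads 64 x^2 \<le> 32 x + 1, impossible
    for x \<ge> 1.\<close>
  obtain i where i: "j = i + 4" using assms le_Suc_ex by (metis add.commute)
  have "2 * ((2 * j + 1) * (4 * size_bound j)) \<le> 4 ^ j"
    using size_bound_le[of j] by (simp add: algebra_simps)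
  moreover have "(4::nat) ^ j = 4 * 4 ^ (j - 1)" using assms by (cases j) auto
  ultimately have "4 ^ (j - 1) \<le> 2 * k + 1"
    using exps by linarith
  moreover have "(4::nat) ^ (j - 1) = 64 * (2 ^ i * 2 ^ i)"
    by (simp add: i power_add four_power mult_2)
  moreover have "2 * k = 32 * 2 ^ i"
    by (simp add: k_def i power_add)
  moreover have "(2::nat) ^ i * 1 \<le> 2 ^ i * 2 ^ i"
    by (intro mult_left_mono) auto
  moreover have "(1::nat) \<le> 2 ^ i" by simp
  ultimately show False by linarith
qed

text \<open>The system with axiom \<open>w\<close>, depth 0 and identity rules generates
  \<open>w\<close>, so the infimum is over a non-empty set and is the size of an actual
  system.\<close>

lemma ell_attained:
  assumes "w \<noteq> []" "c \<ge> 1"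
  shows "\<exists>L. wf_lsystem L \<and> poly_bounded c L \<and> generates L w \<and> lsystem_size L = ell c w"
proof -
  let ?S = "{lsystem_size L | L. wf_lsystem L \<and> poly_bounded c L \<and> generates L w}"
  define L where "L = \<lparr>alphabet = set w, rules = \<lambda>a. [a], coding = id, axiom_str = w,
    depth = 0, out_len = length w\<rparr>"
  have "card (set w) \<le> length w ^ 1"
    using card_length[of w] by simp
  also have "\<dots> \<le> length w ^ c"
    using assms by (intro power_increasing) (auto simp: Suc_le_eq)
  finally have "poly_bounded c L"
    by (simp add: poly_bounded_def L_def)
  moreover have "wf_lsystem L" "generates L w"
    using assms(1) by (auto simp: wf_lsystem_def generates_def iterated_def L_def Suc_le_eq)
  ultimately have "?S \<noteq> {}" by blast
  then have "Inf ?S \<in> ?S" by (rule Inf_nat_def1)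
  then show ?thesis unfolding ell_def by force
qed

text \<open>Since 2j + 1 \<le> 3j, the quotient before rounding is at least 2x with x = 4^j / (48
  j). Rounding loses at most 1, and x \<ge> 1.\<close>

lemma size_bound_ge:
  assumes "j \<ge> 4"
  shows "4 ^ j / (48 * real j) \<le> real (size_bound j)"
proof -
  have growth: "48 * j \<le> 4 ^ j"
    using assms by (induction j rule: dec_induct) auto
  have "4 ^ j / (24 * real j) \<le> 4 ^ j / (8 * (2 * real j + 1))"
    using assms by (intro divide_left_mono) auto
  also have "\<dots> = real (4 ^ j) / real (8 * (2 * j + 1))"
    by simp
  also have "\<dots> \<le> real (size_bound j) + 1"
  proof -
    have "4 ^ j \<le> (size_bound j + 1) * (8 * (2 * j + 1))"
      unfolding size_bound_def using dividend_less_div_times[of "8 * (2 * j + 1)" "4 ^ j"] by simp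
    then have "real (4 ^ j) \<le> real ((size_bound j + 1) * (8 * (2 * j + 1)))"
      by (rule of_nat_mono)
    then show ?thesis
      by (subst pos_divide_le_eq) (simp_all only: of_nat_mult of_nat_add of_nat_1, simp)
  qed
  finally have "4 ^ j / (24 * real j) - 1 \<le> real (size_bound j)" by simp
  moreover have "real (48 * j) \<le> real (4 ^ j)"
    using growth by (rule of_nat_mono)
  then have "1 \<le> 4 ^ j / (48 * real j)"
    using assms by (simp add: field_simps)
  ultimately show ?thesis by (simp add: field_simps)
qed

theorem lemma3:
  "\<exists>F :: nat list set. string_family F \<and>
     (\<forall>c\<ge>1. (\<lambda>w. real (ell c w)) \<in> \<Omega>[along F](\<lambda>w.
        real (z_e w) * log 2 (real (length w)) / log 2 (log 2 (real (length w)))))"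
proof -
  obtain fs where adm: "\<And>j. j \<ge> 4 \<Longrightarrow> fs j \<in> admissible (2 ^ j)"
    and hard: "\<And>j L. j \<ge> 4 \<Longrightarrow> wf_lsystem L \<Longrightarrow> depth L < 2 ^ 4 ^ (j - 1) \<Longrightarrow>
      generates L (runs_word (2 ^ j) (fs j)) \<Longrightarrow> size_bound j \<le> lsystem_size L"
    using exists_hard_word by metis
  define wd where "wd j = runs_word (2 ^ j) (fs j)" for j
  define F where "F = wd ` {4..}"
  have lower: "2 ^ 2 ^ j \<le> length (wd j)" for j
    by (simp add: wd_def runs_word_def)
  have upper: "length (wd j) < 2 ^ (2 * 2 ^ j + 1)" if "j \<ge> 4" for j
    unfolding wd_def using adm[OF that] by (intro length_runs_word_le) (auto simp: admissible_def)
  have long: "j < length (wd j)" for j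
    using lower[of j] less_exp[of "2 ^ j"] less_exp[of j] by linarith
  have unbounded: "\<exists>w\<in>F. m \<le> length w" for m
    using long[of "max 4 m"] by (intro bexI[of _ "wd (max 4 m)"]) (auto simp: F_def)
  have "infinite F"
  proof
    assume "finite F"
    then obtain m where "\<forall>w\<in>F. length w \<le> m"
      using finite_nat_set_iff_bounded_le[of "length ` F"] by auto
    then show False using unbounded[of "Suc m"] by fastforce
  qed
  with unbounded have "string_family F" by (auto simp: string_family_def)
  moreover have "(\<lambda>w. real (ell c w)) \<in> \<Omega>[along F](\<lambda>w.
      real (z_e w) * log 2 (real (length w)) / log 2 (log 2 (real (length w))))"
    if "c \<ge> 1" for c
  \<comment> \<open>The constant is 576 = 4 * 3 * 48: \<open>z_e\<close> is at most 4k, log n at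
    most 3k, and 48 comes from \<open>size_bound_ge\<close>.\<close>
  proof (rule landau_omega.bigI[of "1/576"])
    have ineq: "1/576 * (real (z_e (wd j)) * log 2 (length (wd j)) /
        log 2 (log 2 (length (wd j)))) \<le> real (ell c (wd j))" 
      and nonneg: "0 \<le> real (z_e (wd j)) * log 2 (length (wd j)) /
        log 2 (log 2 (length (wd j)))" if j: "j \<ge> 4" "j \<ge> 12 * c" for j
    proof -
      define k :: nat where "k = 2 ^ j"
      let ?n = "length (wd j)"
      have k: "k \<ge> 1" by (simp add: k_def)
      have scale: "1/576 * x \<le> y" if "x \<le> 576 * real s" "s \<le> t" "y = real t" for x y :: real and s t
        using that by simp
      have "z_e (wd j) = k + 1 + 2 * k"
        using z_e_runs_word[of "fs j" k] adm[OF j(1)]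
        unfolding wd_def admissible_def k_def[symmetric] by (simp add: subset_iff)
      with k have z: "z_e (wd j) \<le> 4 * k" by simp
      have pos: "real ?n > 0" using long[of j] by (simp only: of_nat_0_less_iff)
      have "real ?n \<ge> real (2 ^ k)" using lower[of j] unfolding k_def by (rule of_nat_mono)
      then have log_lower: "real k \<le> log 2 ?n"
        using pos by (simp add: le_log_iff powr_realpow)
      have "real ?n \<le> real (2 ^ (2 * k + 1))"
        using upper[OF j(1)] unfolding k_def by (intro of_nat_mono less_imp_le)
      then have "log 2 ?n \<le> log 2 (2 ^ (2 * k + 1))"
        using pos by (intro log_mono) auto
      also have "\<dots> = real (2 * k + 1)"
        by (rule log_pow_cancel) auto
      finally have "log 2 ?n \<le> real (2 * k + 1)" .
      with k have log_upper: "log 2 ?n \<le> 3 * real k" by simp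
      have "real j = log 2 (real k)" by (simp add: k_def log_nat_power)
      also have "\<dots> \<le> log 2 (log 2 ?n)"
        using log_lower k by (subst log_le_cancel_iff) auto
      finally have loglog: "real j \<le> log 2 (log 2 ?n)" .
      show "0 \<le> real (z_e (wd j)) * log 2 ?n / log 2 (log 2 ?n)"
        using loglog log_lower by (intro divide_nonneg_nonneg mult_nonneg_nonneg) auto
      have "real (z_e (wd j)) * log 2 ?n / log 2 (log 2 ?n) \<le> (4 * real k) * (3 * real k) / real j"
      proof (intro frac_le mult_mono)
        show "real (z_e (wd j)) \<le> 4 * real k" using z by linarith
      qed (use loglog log_upper log_lower j k in auto)
      also have "\<dots> = 576 * (4 ^ j / (48 * real j))"
        by (simp add: k_def power_mult_distrib[symmetric])
      also have "\<dots> \<le> 576 * real (size_bound j)"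
        using size_bound_ge[OF j(1)] by simp
      finally have "real (z_e (wd j)) * log 2 ?n / log 2 (log 2 ?n) \<le> 576 * real (size_bound j)" .
      \<comment> \<open>The minimal system has depth at most n^c, and \<open>j \<ge> 12 * c\<close>
        brings this below the depth bound of \<open>hard\<close>. The exponent \<open>c\<close> thus
        affects only the threshold on \<open>j\<close>, not the family.\<close>
      moreover have "size_bound j \<le> ell c (wd j)"
      proof -
        have "wd j \<noteq> []" using pos by auto
        then obtain L where L: "wf_lsystem L" "poly_bounded c L" "generates L (wd j)"
          "lsystem_size L = ell c (wd j)"
          using ell_attained \<open>c \<ge> 1\<close> by blast
        have "out_len L = ?n" using L(3) by (auto simp: generates_def)
        then have "depth L \<le> ?n ^ c" using L(2) by (simp add: poly_bounded_def)
        also have "\<dots> < (2 ^ (2 * k + 1)) ^ c"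
          using upper[OF j(1)] \<open>c \<ge> 1\<close> unfolding k_def by (intro power_strict_mono) auto
        also have "\<dots> = 2 ^ ((2 * k + 1) * c)" by (simp only: power_mult)
        also have "\<dots> \<le> 2 ^ 4 ^ (j - 1)"
        proof (rule power_increasing)
          have "12 * c \<le> k" using j(2) less_exp[of j] unfolding k_def by linarith
          have "4 * ((2 * k + 1) * c) \<le> 4 * ((3 * k) * c)"
            using k by (intro mult_left_mono mult_right_mono) auto
          also have "\<dots> = k * (12 * c)" by simp
          also have "\<dots> \<le> k * k" using \<open>12 * c \<le> k\<close> by (rule mult_left_mono) simp
          also have "\<dots> = 4 ^ j" by (simp add: k_def power_mult_distrib[symmetric])
          also have "\<dots> = 4 * 4 ^ (j - 1)" using j(1) by (cases j) auto
          finally show "(2 * k + 1) * c \<le> 4 ^ (j - 1)" by simp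
        qed simp
        finally show ?thesis
          using hard[OF j(1) L(1)] L(3,4) unfolding wd_def by metis
      qed
      ultimately show "1/576 * (real (z_e (wd j)) * log 2 ?n / log 2 (log 2 ?n)) \<le> real (ell c (wd j))"
        by (rule scale) simp
    qed
    show "eventually (\<lambda>w. norm (real (ell c w)) \<ge> 1/576 * norm (real (z_e w) *
        log 2 (real (length w)) / log 2 (log 2 (real (length w))))) (along F)"
      unfolding eventually_along
    \<comment> \<open>The threshold is the bound \<open>upper\<close> at index
      \<open>12 * c\<close>, so any word of \<open>F\<close> this long has a larger index.\<close>
    proof (intro exI[of _ "2 ^ (2 * 2 ^ (12 * c) + 1)"] ballI impI)
      fix w assume "w \<in> F" and len: "2 ^ (2 * 2 ^ (12 * c) + 1) \<le> length w"
      then obtain j where j: "j \<ge> 4" "w = wd j" by (auto simp: F_def)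
      have "(2::nat) ^ (2 * 2 ^ (12 * c) + 1) < 2 ^ (2 * 2 ^ j + 1)"
        using len upper[OF j(1)] unfolding j(2) by (rule le_less_trans)
      then have "j \<ge> 12 * c" by simp
      with ineq[OF j(1)] nonneg[OF j(1)] show "norm (real (ell c w)) \<ge> 1/576 *
          norm (real (z_e w) * log 2 (real (length w)) / log 2 (log 2 (real (length w))))"
        unfolding j(2) by (simp only: real_norm_def abs_of_nonneg of_nat_0_le_iff)
    qed
  qed simp
  ultimately show ?thesis by blast
qed

end
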